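(* Let $G=(V,E)$ be a simple undirected graph, let $F:\mathcal G^{\mathrm{op}}\to\mathsf Q\mathsf{Cat}$ be a network sheaf on $G$ and let $W:V\times V\to Q$ be a weighting on $G$. Then the objects of the $\mathsf Q$-category $\Gamma_WF$ of $W$-weighted global sections are the $W$-fuzzy global sections of $F$. Moreover, given two $W$-fuzzy global sections $\vec x=(x_v)_{v\in V}$ and $\vec y=(y_v)_{v\in V}$, we have $$\hom_{\Gamma_WF}(\vec x,\vec y)=\hom_{C^0F}(\vec x,\vec y)=\bigwedge_{v\in V}\hom_{Fv}(x_v,y_v).$$
   Context: Throughout, $\mathsf Q=(Q,\preceq,\cdot,1)$ is a commutative, unital, semicartesian quantale: $(Q,\preceq)$ is a complete lattice, $\cdot$ is an associative commutative operation with unit $1$ that distributes over arbitrary joins in each variable, and $p\cdot q\preceq p\wedge q$ for all $p,q$ (so $1=\top$). A (small) $\mathsf Q$-category $\mathsf C$ is a set $\mathrm{ob}(\mathsf C)$ with elements $\hom_{\mathsf C}(x,y)\in Q$ such that $\hom_{\mathsf C}(x,x)=1$ and $\hom_{\mathsf C}(x,y)\cdot\hom_{\mathsf C}(y,z)\preceq\hom_{\mathsf C}(x,z)$. A $\mathsf Q$-functor $F:\mathsf C\to\mathsf D$ is a function on objects with $\hom_{\mathsf C}(x,y)\preceq\hom_{\mathsf D}(Fx,Fy)$. $\mathsf Q\mathsf{Cat}$ is the category of $\mathsf Q$-categories and $\mathsf Q$-functors. For $\mathsf Q$-categories $\mathsf C,\mathsf D$, the functor $\mathsf Q$-category $[\mathsf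 C,\mathsf D]$ has $\mathsf Q$-functors as objects and $\hom_{[\mathsf C,\mathsf D]}(F,G)=\bigwedge_{x\in\mathsf C}\hom_{\mathsf D}(Fx,Gx)$. Notation: $x\preceq_q y$ means $\hom(x,y)\succeq q$; $x\approx_q y$ means $x\preceq_q y$ and $y\preceq_q x$; for parallel functors $F\approx_q G$ is meant pointwise. For $e\in E$ (a two-element subset of $V$), $\partial e$ is its set of endpoints. The incidence poset $\mathcal G^{\mathrm{op}}$ has underlying set $V\sqcup E$ and relations $v\triangleleft e$ whenever $v\in\partial e$. A network sheaf $F:\mathcal G^{\mathrm{op}}\to\mathsf Q\mathsf{Cat}$ is a functor: a $\mathsf Q$-category $F\sigma$ for each $\sigma\in V\sqcup E$ and a $\mathsf Q$-functor $F_{v\triangleleft e}:Fv\to Fe$ for each $v\in\partial e$. $C^0F=\prod_{v\in V}Fv$ is the product $\mathsf Q$-category (objects are tuples, hom is the meet of the componentwise homs). A $W$-fuzzy global section of $F$ is an object $(x_v)_{v\in V}$ of $C^0F$ such that for every edge $e$ with $\partial e=\{v,w\}$: $F_{v\triangleleft e}x_v\preceq_{W(v,w)}F_{w\triangleleft e}x_w$ and $F_{w\triangleleft e}x_w\preceq_{W(w,v)}F_{v\triangleleft e}x_v$. The weight functor $\widetilde W:\mathcal G^{\mathrm{op}}\to\mathsf Q\mathsf{Cat}$: $\widetilde W(v)=\{v\}$ is the one-object $\mathsf Q$-category; for $\partial e=\{v,w\}$, $\widetilde W(e)=\Delta(e)$ is the $\mathsf Q$-category with objects $v,w$ and $\hom_{\Delta(e)}(v,w)=W(v,w)$,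 $\hom_{\Delta(e)}(w,v)=W(w,v)$ (and $\hom(v,v)=\hom(w,w)=1$); $\widetilde W(v\triangleleft e)$ is the embedding $\{v\}\hookrightarrow\Delta(e)$ picking out $v$. For functors $H,K:\mathcal G^{\mathrm{op}}\to\mathsf Q\mathsf{Cat}$, a pseudonatural transformation $\alpha:H\Rightarrow K$ consists of $\mathsf Q$-functors $\alpha_\sigma:H\sigma\to K\sigma$ for $\sigma\in V\sqcup E$ such that $\alpha_e\circ H_{v\triangleleft e}\approx_1 K_{v\triangleleft e}\circ\alpha_v$ for all $v\triangleleft e$. These form a $\mathsf Q$-category $[H,K]$ with $\hom_{[H,K]}(\alpha,\beta)=\bigwedge_\sigma\hom_{[H\sigma,K\sigma]}(\alpha_\sigma,\beta_\sigma)$. $\Gamma_WF$, the $\mathsf Q$-category of $W$-weighted global sections, is the limit of $F$ weighted by $\widetilde W$ in the $\mathsf Q\mathsf{Cat}$-enriched category of $\mathsf Q$-categories (whose hom objects are the functor $\mathsf Q$-categories $[\mathsf C,\mathsf D]$): the $\mathsf Q$-category with isomorphisms $[\mathsf X,\Gamma_WF]\cong[\widetilde W,[\mathsf X,F-]]$ natural in the $\mathsf Q$-category $\mathsf X$.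
   Formalization: "The objects of Γ_W F are the W-fuzzy global sections" is stated as: the underlying tuples are exactly the fuzzy sections, objects with equal tuples are ≈_1, and it is a literal bijection if every Fe is skeletal; a literal bijection fails when Fe has distinct ≈_1-related objects. *)

theory Defs
  imports Main "HOL-Library.FuncSet"
begin

section \<open>Quantales and categories enriched in them\<close>

class semicartesian_quantale = complete_lattice + comm_monoid_mult +
  assumes mult_Sup_distrib: "p * Sup A = Sup ((\<lambda>q. p * q) ` A)"
    and mult_le_inf: "p * q \<le> inf p q"

text \<open>
  A category enriched in a quantale has a carrier set \<open>Ob\<close>; the values of \<open>Hom\<close> outside the
  carrier are irrelevant. All maps between carriers are extensional (undefined off their domain),
  so that equality of functors and of transformations is equality in the logic.
\<close>

record ('o, 'q) qcat =
  Ob :: "'o set"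
  Hom :: "'o \<Rightarrow> 'o \<Rightarrow> 'q"

definition is_qcat :: "('o, 'q::semicartesian_quantale) qcat \<Rightarrow> bool" where
  "is_qcat C \<longleftrightarrow>
    (\<forall>x\<in>Ob C. Hom C x x = 1) \<and>
    (\<forall>x\<in>Ob C. \<forall>y\<in>Ob C. \<forall>z\<in>Ob C. Hom C x y * Hom C y z \<le> Hom C x z)"

definition qle :: "('o, 'q::semicartesian_quantale) qcat \<Rightarrow> 'q \<Rightarrow> 'o \<Rightarrow> 'o \<Rightarrow> bool" where
  "qle C q x y \<longleftrightarrow> q \<le> Hom C x y"

definition qapprox :: "('o, 'q::semicartesian_quantale) qcat \<Rightarrow> 'q \<Rightarrow> 'o \<Rightarrow> 'o \<Rightarrow> bool" where
  "qapprox C q x y \<longleftrightarrow> qle C q x y \<and> qle C q y x"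

definition skeletal :: "('o, 'q::semicartesian_quantale) qcat \<Rightarrow> bool" where
  "skeletal C \<longleftrightarrow> (\<forall>x\<in>Ob C. \<forall>y\<in>Ob C. qapprox C 1 x y \<longrightarrow> x = y)"

definition functors ::
    "('c, 'q::semicartesian_quantale) qcat \<Rightarrow> ('d, 'q) qcat \<Rightarrow> ('c \<Rightarrow> 'd) set" where
  "functors C D =
    {f \<in> Ob C \<rightarrow>\<^sub>E Ob D. \<forall>x\<in>Ob C. \<forall>y\<in>Ob C. Hom C x y \<le> Hom D (f x) (f y)}"

definition functor_qapprox ::
    "('c, 'q::semicartesian_quantale) qcat \<Rightarrow> ('d, 'q) qcat \<Rightarrow> 'q \<Rightarrow> ('c \<Rightarrow> 'd) \<Rightarrow> ('c \<Rightarrow> 'd) \<Rightarrow> bool"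
  where
  "functor_qapprox C D q f g \<longleftrightarrow> (\<forall>x\<in>Ob C. qapprox D q (f x) (g x))"

definition functor_qcat ::
    "('c, 'q::semicartesian_quantale) qcat \<Rightarrow> ('d, 'q) qcat \<Rightarrow> ('c \<Rightarrow> 'd, 'q) qcat" where
  "functor_qcat C D =
    \<lparr>Ob = functors C D, Hom = (\<lambda>f g. INF x\<in>Ob C. Hom D (f x) (g x))\<rparr>"

definition is_qiso ::
    "('c, 'q::semicartesian_quantale) qcat \<Rightarrow> ('d, 'q) qcat \<Rightarrow> ('c \<Rightarrow> 'd) \<Rightarrow> bool" where
  "is_qiso C D f \<longleftrightarrow> f \<in> functors C D \<and>
    (\<exists>g \<in> functors D C. (\<forall>x\<in>Ob C. g (f x) = x) \<and> (\<forall>y\<in>Ob D. f (g y) = y))"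

definition unit_qcat :: "'o \<Rightarrow> ('o, 'q::semicartesian_quantale) qcat" where
  "unit_qcat a = \<lparr>Ob = {a}, Hom = (\<lambda>_ _. 1)\<rparr>"


section \<open>Diagrams on the incidence poset of a graph\<close>

definition simple_graph :: "'v set \<Rightarrow> 'v set set \<Rightarrow> bool" where
  "simple_graph V E \<longleftrightarrow> (\<forall>e\<in>E. e \<subseteq> V \<and> card e = 2)"

text \<open>
  The incidence poset has carrier \<open>V <+> E\<close>, and \<open>v\<close> lies below \<open>e\<close> iff \<open>v \<in> e\<close>. It has no
  composable pairs of non-identity arrows, so a functor out of it is just a family of objects
  (\<open>dobj\<close>) together with a morphism (\<open>dres\<close>) for each incidence \<open>v \<in> e\<close>.
\<close>

record ('v, 'o, 'q) diagram =
  dobj :: "'v + 'v set \<Rightarrow> ('o, 'q) qcat"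
  dres :: "'v \<Rightarrow> 'v set \<Rightarrow> 'o \<Rightarrow> 'o"

definition is_diagram ::
    "'v set \<Rightarrow> 'v set set \<Rightarrow> ('v, 'o, 'q::semicartesian_quantale) diagram \<Rightarrow> bool" where
  "is_diagram V E H \<longleftrightarrow>
    (\<forall>\<sigma>\<in>V <+> E. is_qcat (dobj H \<sigma>)) \<and>
    (\<forall>e\<in>E. \<forall>v\<in>e. dres H v e \<in> functors (dobj H (Inl v)) (dobj H (Inr e)))"

abbreviation network_sheaf ::
    "'v set \<Rightarrow> 'v set set \<Rightarrow> ('v, 'o, 'q::semicartesian_quantale) diagram \<Rightarrow> bool" where
  "network_sheaf \<equiv> is_diagram"

definition zero_cochains ::
    "'v set \<Rightarrow> ('v, 'o, 'q::semicartesian_quantale) diagram \<Rightarrow> ('v \<Rightarrow> 'o, 'q) qcat" where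
  "zero_cochains V F =
    \<lparr>Ob = (\<Pi>\<^sub>E v\<in>V. Ob (dobj F (Inl v))),
     Hom = (\<lambda>x y. INF v\<in>V. Hom (dobj F (Inl v)) (x v) (y v))\<rparr>"

definition fuzzy_sections ::
    "'v set \<Rightarrow> 'v set set \<Rightarrow> ('v \<Rightarrow> 'v \<Rightarrow> 'q) \<Rightarrow>
     ('v, 'o, 'q::semicartesian_quantale) diagram \<Rightarrow> ('v \<Rightarrow> 'o) set" where
  "fuzzy_sections V E W F =
    {x \<in> Ob (zero_cochains V F). \<forall>e\<in>E. \<forall>v w. e = {v, w} \<longrightarrow>
       qle (dobj F (Inr e)) (W v w) (dres F v e (x v)) (dres F w e (x w)) \<and>
       qle (dobj F (Inr e)) (W w v) (dres F w e (x w)) (dres F v e (x v))}"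


section \<open>Weighted global sections\<close>

definition weight_diagram ::
    "('v \<Rightarrow> 'v \<Rightarrow> 'q) \<Rightarrow> ('v, 'v, 'q::semicartesian_quantale) diagram" where
  "weight_diagram W =
    \<lparr>dobj = case_sum (\<lambda>v. unit_qcat v)
       (\<lambda>e. \<lparr>Ob = e, Hom = (\<lambda>v w. if v = w then 1 else W v w)\<rparr>),
     dres = (\<lambda>v e. \<lambda>u\<in>{v}. u)\<rparr>"

definition pseudonat ::
    "'v set \<Rightarrow> 'v set set \<Rightarrow> ('v, 'h, 'q::semicartesian_quantale) diagram \<Rightarrow>
     ('v, 'k, 'q) diagram \<Rightarrow> ('v + 'v set \<Rightarrow> 'h \<Rightarrow> 'k) set" where
  "pseudonat V E H K =
    {\<alpha> \<in> (\<Pi>\<^sub>E \<sigma>\<in>V <+> E. functors (dobj H \<sigma>) (dobj K \<sigma>)). \<forall>e\<in>E. \<forall>v\<in>e.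
       functor_qapprox (dobj H (Inl v)) (dobj K (Inr e)) 1
         (\<alpha> (Inr e) \<circ> dres H v e) (dres K v e \<circ> \<alpha> (Inl v))}"

definition pseudonat_qcat ::
    "'v set \<Rightarrow> 'v set set \<Rightarrow> ('v, 'h, 'q::semicartesian_quantale) diagram \<Rightarrow>
     ('v, 'k, 'q) diagram \<Rightarrow> ('v + 'v set \<Rightarrow> 'h \<Rightarrow> 'k, 'q) qcat" where
  "pseudonat_qcat V E H K =
    \<lparr>Ob = pseudonat V E H K,
     Hom = (\<lambda>\<alpha> \<beta>. INF \<sigma>\<in>V <+> E. Hom (functor_qcat (dobj H \<sigma>) (dobj K \<sigma>)) (\<alpha> \<sigma>) (\<beta> \<sigma>))\<rparr>"

text \<open>The diagram \<open>[X, F-]\<close>, acting on incidences by post-composition.\<close>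

definition power_diagram ::
    "('x, 'q::semicartesian_quantale) qcat \<Rightarrow> ('v, 'o, 'q) diagram \<Rightarrow> ('v, 'x \<Rightarrow> 'o, 'q) diagram"
  where
  "power_diagram X F =
    \<lparr>dobj = (\<lambda>\<sigma>. functor_qcat X (dobj F \<sigma>)),
     dres = (\<lambda>v e. \<lambda>f\<in>functors X (dobj F (Inl v)). compose (Ob X) (dres F v e) f)\<rparr>"

text \<open>The map \<open>[H, [X, F-]] \<rightarrow> [H, [Y, F-]]\<close> given by pre-composition with \<open>u : Y \<rightarrow> X\<close>.\<close>

definition precompose ::
    "'v set \<Rightarrow> 'v set set \<Rightarrow> ('v, 'h, 'q::semicartesian_quantale) diagram \<Rightarrow> ('y, 'q) qcat \<Rightarrow>
     ('y \<Rightarrow> 'x) \<Rightarrow> ('v + 'v set \<Rightarrow> 'h \<Rightarrow> 'x \<Rightarrow> 'o) \<Rightarrow> ('v + 'v set \<Rightarrow> 'h \<Rightarrow> 'y \<Rightarrow> 'o)" where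
  "precompose V E H Y u \<alpha> =
    (\<lambda>\<sigma>\<in>V <+> E. \<lambda>h\<in>Ob (dobj H \<sigma>). compose (Ob Y) (\<alpha> \<sigma> h) u)"

text \<open>
  \<open>L\<close> is a limit of \<open>F\<close> weighted by \<open>H\<close>, as witnessed by isomorphisms
  \<open>\<theta> X : [X, L] \<cong> [H, [X, F-]]\<close> natural in \<open>X\<close>. Since one cannot quantify over types, \<open>X\<close> ranges
  over all categories with objects in the type \<open>'x\<close>, on which nothing is imposed.
\<close>

definition is_weighted_limit ::
    "'v set \<Rightarrow> 'v set set \<Rightarrow> ('v, 'h, 'q::semicartesian_quantale) diagram \<Rightarrow>
     ('v, 'o, 'q) diagram \<Rightarrow> ('l, 'q) qcat \<Rightarrow>
     (('x, 'q) qcat \<Rightarrow> ('x \<Rightarrow> 'l) \<Rightarrow> ('v + 'v set \<Rightarrow> 'h \<Rightarrow> 'x \<Rightarrow> 'o)) \<Rightarrow> bool" where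
  "is_weighted_limit V E H F L \<theta> \<longleftrightarrow> is_qcat L \<and>
    (\<forall>X. is_qcat X \<longrightarrow>
       is_qiso (functor_qcat X L) (pseudonat_qcat V E H (power_diagram X F)) (\<theta> X)) \<and>
    (\<forall>X Y. is_qcat X \<longrightarrow> is_qcat Y \<longrightarrow> (\<forall>u\<in>functors Y X. \<forall>f\<in>functors X L.
       \<theta> Y (compose (Ob Y) f u) = precompose V E H Y u (\<theta> X f)))"

abbreviation is_weighted_global_sections where
  "is_weighted_global_sections V E W F \<Gamma> \<theta> \<equiv>
    is_weighted_limit V E (weight_diagram W) F \<Gamma> \<theta>"

text \<open>
  The tuple underlying an object \<open>g\<close> of the weighted limit: \<open>g\<close> is a functor from the one-object
  category on \<open>a\<close>, which \<open>\<theta>\<close> sends to a pseudonatural transformation from the weight to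
  \<open>[{a}, F-]\<close>; take its components at the vertices. By naturality the choice of \<open>a\<close> is
  immaterial. The components at the edges are pinned down by the tuple only up to \<open>\<approx>\<^sub>1\<close>, so distinct
  objects of the limit may have the same underlying tuple unless the edge categories are skeletal.
\<close>

definition underlying_tuple ::
    "'v set \<Rightarrow> (('x, 'q::semicartesian_quantale) qcat \<Rightarrow> ('x \<Rightarrow> 'l) \<Rightarrow> ('v + 'v set \<Rightarrow> 'v \<Rightarrow> 'x \<Rightarrow> 'o)) \<Rightarrow>
     'x \<Rightarrow> 'l \<Rightarrow> 'v \<Rightarrow> 'o" where
  "underlying_tuple V \<theta> a g = (\<lambda>v\<in>V. \<theta> (unit_qcat a) (\<lambda>_\<in>{a}. g) (Inl v) v a)"

end

theory Submission
  imports Defs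
begin

text \<open>
  Evaluating \<open>[X, \<Gamma>] \<cong> [W, [X, F-]]\<close> at the one-object category identifies \<open>\<Gamma>\<close> with the
  category of pseudonatural transformations from the weight to \<open>F\<close>. The vertex components of such a
  transformation form a tuple \<open>x\<close>; pseudonaturality forces the edge component at \<open>v \<in> e\<close> to be
  \<open>\<approx>\<^sub>1\<close>-isomorphic to the restriction of \<open>x v\<close>, and functoriality of the edge components then says
  that \<open>x\<close> is a fuzzy section. Since homs are invariant under \<open>\<approx>\<^sub>1\<close> and the restriction maps do not
  decrease homs, the edges contribute nothing new to the meet that defines the hom.
\<close>

section \<open>Homs up to isomorphism, and isomorphisms of enriched categories\<close>

lemma le_one: "q \<le> (1::'q::semicartesian_quantale)"
  using mult_le_inf[of q 1] by simp

text \<open>The unit is the top element, so a hom that is at least 1 equals 1. The equations let 1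
  cancel in the composition inequality.\<close>

lemma qapprox_one_iff: "qapprox C 1 x y \<longleftrightarrow> Hom C x y = 1 \<and> Hom C y x = 1"
  by (auto simp: qapprox_def qle_def intro: antisym le_one)

lemma is_qcat_Hom_self: "is_qcat C \<Longrightarrow> x \<in> Ob C \<Longrightarrow> Hom C x x = 1"
  by (simp add: is_qcat_def)

text \<open>Compose with the arrows from \<open>x'\<close> to \<open>x\<close> and from
  \<open>y\<close> to \<open>y'\<close>: both have hom 1, so the composition inequality loses
  nothing on either side.\<close>

lemma Hom_qapprox_le:
  assumes "is_qcat C" "x \<in> Ob C" "y \<in> Ob C" "x' \<in> Ob C" "y' \<in> Ob C"
    and "qapprox C 1 x x'" "qapprox C 1 y y'"
  shows "Hom C x y \<le> Hom C x' y'"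
proof -
  have trans: "Hom C p q * Hom C q r \<le> Hom C p r" if "p \<in> Ob C" "q \<in> Ob C" "r \<in> Ob C" for p q r
    using assms(1) that by (simp add: is_qcat_def)
  have "Hom C x y \<le> Hom C x' y"
    using trans[of x' x y] assms by (simp add: qapprox_one_iff)
  also have "\<dots> \<le> Hom C x' y'"
    using trans[of x' y y'] assms by (simp add: qapprox_one_iff)
  finally show ?thesis .
qed

lemma functors_Ob: "f \<in> functors C D \<Longrightarrow> x \<in> Ob C \<Longrightarrow> f x \<in> Ob D"
  by (auto simp: functors_def)

lemma functors_Hom_le:
  "f \<in> functors C D \<Longrightarrow> x \<in> Ob C \<Longrightarrow> y \<in> Ob C \<Longrightarrow> Hom C x y \<le> Hom D (f x) (f y)"
  by (auto simp: functors_def)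

lemma Ob_functor_qcat [simp]: "Ob (functor_qcat C D) = functors C D"
  by (simp add: functor_qcat_def)

text \<open>Neither a functor nor its inverse decreases homs, so the two inequalities meet.\<close>

lemma is_qiso_Hom:
  assumes "is_qiso C D f" "x \<in> Ob C" "y \<in> Ob C"
  shows "Hom D (f x) (f y) = Hom C x y"
proof -
  from assms(1) obtain g where f: "f \<in> functors C D" and g: "g \<in> functors D C"
    and gf: "\<forall>x\<in>Ob C. g (f x) = x" by (auto simp: is_qiso_def)
  show ?thesis
  proof (rule antisym)
    show "Hom D (f x) (f y) \<le> Hom C x y"
      using functors_Hom_le[OF g functors_Ob[OF f assms(2)] functors_Ob[OF f assms(3)]] gf assms
      by simp
    show "Hom C x y \<le> Hom D (f x) (f y)"
      using functors_Hom_le[OF f] assms by simp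
  qed
qed

lemma is_qiso_bij_betw:
  assumes "is_qiso C D f"
  shows "bij_betw f (Ob C) (Ob D)"
proof -
  from assms obtain g where f: "f \<in> functors C D" and g: "g \<in> functors D C"
    and inv: "\<forall>x\<in>Ob C. g (f x) = x" "\<forall>y\<in>Ob D. f (g y) = y" by (auto simp: is_qiso_def)
  show ?thesis
    using functors_Ob[OF f] functors_Ob[OF g] inv by (intro bij_betw_byWitness[of _ g]) auto
qed

section \<open>Functors out of the one-object category\<close>

lemma is_qcat_unit_qcat: "is_qcat (unit_qcat a)"
  by (simp add: is_qcat_def unit_qcat_def)

text \<open>The only hom condition compares 1 with the self-hom of \<open>f a\<close>, which is 1 in
  a category.\<close>

lemma functors_unit_qcat:
  assumes "is_qcat D"
  shows "functors (unit_qcat a) D = {a} \<rightarrow>\<^sub>E Ob D"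
  using is_qcat_Hom_self[OF assms, OF PiE_mem[of _ "{a}" "\<lambda>_. Ob D" a]]
  by (auto simp: functors_def unit_qcat_def)

lemma Hom_functor_qcat_unit_qcat [simp]:
  "Hom (functor_qcat (unit_qcat a) D) f g = Hom D (f a) (g a)"
  by (simp add: functor_qcat_def unit_qcat_def)

lemma is_qcat_functor_qcat_unit_qcat:
  assumes "is_qcat D"
  shows "is_qcat (functor_qcat (unit_qcat a) D)"
  using assms by (auto simp: is_qcat_def functors_unit_qcat PiE_iff)

text \<open>Evaluation at \<open>a\<close> inverts the formation of constant functors;
  extensionality makes a functor on \<open>{a}\<close> equal to the constant one on its
  value.\<close>

lemma functor_qcat_unit_qcat_bij_betw:
  assumes "is_qcat D"
  shows "bij_betw (\<lambda>d. \<lambda>_\<in>{a}. d) (Ob D) (functors (unit_qcat a) D)"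
  unfolding functors_unit_qcat[OF assms]
proof (rule bij_betw_byWitness[where f' = "\<lambda>f. f a"])
  show "\<forall>f\<in>{a} \<rightarrow>\<^sub>E Ob D. (\<lambda>_\<in>{a}. f a) = f"
    by (auto simp: fun_eq_iff PiE_def extensional_def)
  show "(\<lambda>d. \<lambda>_\<in>{a}. d) ` Ob D \<subseteq> {a} \<rightarrow>\<^sub>E Ob D"
    by (intro image_subsetI restrict_PiE_iff[THEN iffD2]) simp
qed auto

lemma PiE_PiE_mem:
  assumes "f \<in> A \<rightarrow>\<^sub>E B \<rightarrow>\<^sub>E C" "x \<in> A" "y \<in> B"
  shows "f x y \<in> C"
  using PiE_mem[OF PiE_mem[OF assms(1,2)] assms(3)] .

section \<open>Pseudonatural transformations from the weight to the sheaf\<close>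

lemma simple_graph_edge:
  assumes "simple_graph V E" "e \<in> E"
  shows "e \<subseteq> V" "e = {v, w} \<Longrightarrow> v \<noteq> w"
    and "v \<in> e \<Longrightarrow> w \<in> e \<Longrightarrow> v \<noteq> w \<Longrightarrow> e = {v, w}"
proof -
  have e: "e \<subseteq> V" "card e = 2" using assms by (auto simp: simple_graph_def)
  show "e \<subseteq> V" by fact
  show "e = {v, w} \<Longrightarrow> v \<noteq> w" using e by auto
  show "v \<in> e \<Longrightarrow> w \<in> e \<Longrightarrow> v \<noteq> w \<Longrightarrow> e = {v, w}" using e(2) by (auto simp: card_2_iff)
qed

context
  fixes V :: "'v set" and E :: "'v set set"
    and W :: "'v \<Rightarrow> 'v \<Rightarrow> 'q::semicartesian_quantale"
    and F :: "('v, 'o, 'q) diagram"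
    and a :: 'x
  assumes G: "simple_graph V E" and F: "network_sheaf V E F"
begin

text \<open>The right-hand side of the universal property at a one-object category. Values of a
  component are functors on \<open>{a}\<close> rather than objects of the sheaf, hence the trailing
  argument \<open>a\<close> below.\<close>

abbreviation point_sections :: "('v + 'v set \<Rightarrow> 'v \<Rightarrow> 'x \<Rightarrow> 'o, 'q) qcat" where
  "point_sections \<equiv>
    pseudonat_qcat V E (weight_diagram W) (power_diagram (unit_qcat a) F)"

definition vertex_tuple :: "('v + 'v set \<Rightarrow> 'v \<Rightarrow> 'x \<Rightarrow> 'o) \<Rightarrow> 'v \<Rightarrow> 'o" where
  "vertex_tuple \<alpha> = (\<lambda>v\<in>V. \<alpha> (Inl v) v a)"

lemma sheaf_is_qcat:
  "v \<in> V \<Longrightarrow> is_qcat (dobj F (Inl v))" "e \<in> E \<Longrightarrow> is_qcat (dobj F (Inr e))"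
  using F by (auto simp: is_diagram_def)

lemma sheaf_restriction:
  "e \<in> E \<Longrightarrow> v \<in> e \<Longrightarrow> dres F v e \<in> functors (dobj F (Inl v)) (dobj F (Inr e))"
  using F by (auto simp: is_diagram_def)

lemma edge_vertex: "e \<in> E \<Longrightarrow> v \<in> e \<Longrightarrow> v \<in> V"
  using simple_graph_edge(1)[OF G] by auto

lemma sheaf_restriction_Ob:
  "e \<in> E \<Longrightarrow> v \<in> e \<Longrightarrow> x \<in> Ob (dobj F (Inl v)) \<Longrightarrow> dres F v e x \<in> Ob (dobj F (Inr e))"
  using functors_Ob[OF sheaf_restriction] .

text \<open>Unfolds functoriality and pseudonaturality into conditions on objects of the sheaf. The
  weight bounds only pairs of distinct endpoints: on the diagonal the weight has hom 1, matched by
  the self-hom in the edge category.\<close>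

lemma point_sections_iff:
  "\<alpha> \<in> Ob point_sections \<longleftrightarrow>
    \<alpha> \<in> extensional (V <+> E) \<and>
    (\<forall>v\<in>V. \<alpha> (Inl v) \<in> {v} \<rightarrow>\<^sub>E {a} \<rightarrow>\<^sub>E Ob (dobj F (Inl v))) \<and>
    (\<forall>e\<in>E. \<alpha> (Inr e) \<in> e \<rightarrow>\<^sub>E {a} \<rightarrow>\<^sub>E Ob (dobj F (Inr e))) \<and>
    (\<forall>e\<in>E. \<forall>v\<in>e. \<forall>w\<in>e. v \<noteq> w \<longrightarrow>
       W v w \<le> Hom (dobj F (Inr e)) (\<alpha> (Inr e) v a) (\<alpha> (Inr e) w a)) \<and>
    (\<forall>e\<in>E. \<forall>v\<in>e.
       qapprox (dobj F (Inr e)) 1 (\<alpha> (Inr e) v a) (dres F v e (\<alpha> (Inl v) v a)))"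
  (is "?L \<longleftrightarrow> ?ext \<and> ?vert \<and> ?edge \<and> ?weight \<and> ?nat")
proof -
  let ?H = "weight_diagram W" and ?K = "power_diagram (unit_qcat a) F"
  have vert: "functors (dobj ?H (Inl v)) (dobj ?K (Inl v)) =
      {v} \<rightarrow>\<^sub>E {a} \<rightarrow>\<^sub>E Ob (dobj F (Inl v))" if "v \<in> V" for v
    using sheaf_is_qcat(1)[OF that]
    by (simp add: weight_diagram_def power_diagram_def functors_unit_qcat
        is_qcat_functor_qcat_unit_qcat)
  have edge: "functors (dobj ?H (Inr e)) (dobj ?K (Inr e)) =
      {f \<in> e \<rightarrow>\<^sub>E {a} \<rightarrow>\<^sub>E Ob (dobj F (Inr e)). \<forall>v\<in>e. \<forall>w\<in>e. v \<noteq> w \<longrightarrow>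
         W v w \<le> Hom (dobj F (Inr e)) (f v a) (f w a)}" if "e \<in> E" for e
    using is_qcat_Hom_self[OF sheaf_is_qcat(2)[OF that]]
    by (auto simp: weight_diagram_def power_diagram_def functors_unit_qcat sheaf_is_qcat that
        functors_def[of "\<lparr>Ob = e, Hom = _\<rparr>"] PiE_iff)
  let ?fam = "\<alpha> \<in> (\<Pi>\<^sub>E \<sigma>\<in>V <+> E. functors (dobj ?H \<sigma>) (dobj ?K \<sigma>))"
  let ?pseudo = "\<forall>e\<in>E. \<forall>v\<in>e. functor_qapprox (dobj ?H (Inl v)) (dobj ?K (Inr e)) 1
    (\<alpha> (Inr e) \<circ> dres ?H v e) (dres ?K v e \<circ> \<alpha> (Inl v))"
  have "?fam \<longleftrightarrow> ?ext \<and>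
      (\<forall>v\<in>V. \<alpha> (Inl v) \<in> functors (dobj ?H (Inl v)) (dobj ?K (Inl v))) \<and>
      (\<forall>e\<in>E. \<alpha> (Inr e) \<in> functors (dobj ?H (Inr e)) (dobj ?K (Inr e)))"
    by (auto simp: PiE_iff)
  moreover have "(\<forall>v\<in>V. \<alpha> (Inl v) \<in> functors (dobj ?H (Inl v)) (dobj ?K (Inl v))) \<longleftrightarrow> ?vert"
    by (intro ball_cong refl) (simp only: vert)
  moreover have "(\<forall>e\<in>E. \<alpha> (Inr e) \<in> functors (dobj ?H (Inr e)) (dobj ?K (Inr e)))
      \<longleftrightarrow> ?edge \<and> ?weight"
    unfolding ball_conj_distrib[symmetric] by (intro ball_cong refl) (simp only: edge mem_Collect_eq)
  ultimately have fam: "?fam \<longleftrightarrow> ?ext \<and> ?vert \<and> ?edge \<and> ?weight" by (simp only:)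
  \<comment> \<open>The equivalence needs \<open>?vert\<close>: restriction in the power diagram is
    post-composition only on actual functors, so the vertex component must first be known to take
    its value there.\<close>
  have pseudo: "?pseudo \<longleftrightarrow> ?nat" if *: ?vert
  proof (intro ball_cong refl)
    fix e v assume e: "e \<in> E" "v \<in> e"
    have "\<alpha> (Inl v) \<in> {v} \<rightarrow>\<^sub>E {a} \<rightarrow>\<^sub>E Ob (dobj F (Inl v))"
      using bspec[OF * edge_vertex[OF e]] .
    then have "\<alpha> (Inl v) v \<in> {a} \<rightarrow>\<^sub>E Ob (dobj F (Inl v))"
      by (rule PiE_mem) simp
    then have "\<alpha> (Inl v) v \<in> functors (unit_qcat a) (dobj F (Inl v))"
      using edge_vertex[OF e] by (simp add: functors_unit_qcat sheaf_is_qcat)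
    then show "functor_qapprox (dobj ?H (Inl v)) (dobj ?K (Inr e)) 1
         (\<alpha> (Inr e) \<circ> dres ?H v e) (dres ?K v e \<circ> \<alpha> (Inl v)) \<longleftrightarrow>
      qapprox (dobj F (Inr e)) 1 (\<alpha> (Inr e) v a) (dres F v e (\<alpha> (Inl v) v a))"
      by (simp add: functor_qapprox_def weight_diagram_def power_diagram_def unit_qcat_def[of v]
          qapprox_def qle_def) (simp add: unit_qcat_def compose_def)
  qed
  have "?L \<longleftrightarrow> ?fam \<and> ?pseudo"
    by (simp add: pseudonat_qcat_def pseudonat_def)
  also have "\<dots> \<longleftrightarrow> (?ext \<and> ?vert \<and> ?edge \<and> ?weight) \<and> ?nat"
    by (rule conj_cong[OF fam]) (elim conjE, rule pseudo)
  finally show ?thesis by (simp only: conj_assoc)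
qed

lemma point_sectionsD:
  assumes "\<alpha> \<in> Ob point_sections"
  shows "\<alpha> \<in> extensional (V <+> E)"
    and "\<forall>v\<in>V. \<alpha> (Inl v) \<in> {v} \<rightarrow>\<^sub>E {a} \<rightarrow>\<^sub>E Ob (dobj F (Inl v))"
    and "\<forall>e\<in>E. \<alpha> (Inr e) \<in> e \<rightarrow>\<^sub>E {a} \<rightarrow>\<^sub>E Ob (dobj F (Inr e))"
    and "\<forall>e\<in>E. \<forall>v\<in>e. \<forall>w\<in>e. v \<noteq> w \<longrightarrow>
       W v w \<le> Hom (dobj F (Inr e)) (\<alpha> (Inr e) v a) (\<alpha> (Inr e) w a)"
    and "\<forall>e\<in>E. \<forall>v\<in>e.
       qapprox (dobj F (Inr e)) 1 (\<alpha> (Inr e) v a) (dres F v e (\<alpha> (Inl v) v a))"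
  using assms unfolding point_sections_iff by - (elim conjE, assumption)+

lemma vertex_tuple_Ob:
  assumes "\<alpha> \<in> Ob point_sections" "v \<in> V"
  shows "vertex_tuple \<alpha> v \<in> Ob (dobj F (Inl v))"
  using PiE_PiE_mem[OF bspec[OF point_sectionsD(2)[OF assms(1)] assms(2)], of v a] assms(2)
  by (simp add: vertex_tuple_def)

lemma edge_component_Ob:
  assumes "\<alpha> \<in> Ob point_sections" "e \<in> E" "v \<in> e"
  shows "\<alpha> (Inr e) v a \<in> Ob (dobj F (Inr e))"
  using PiE_PiE_mem[OF bspec[OF point_sectionsD(3)[OF assms(1)] assms(2)] assms(3), of a] by simp

lemma edge_component_qapprox:
  assumes "\<alpha> \<in> Ob point_sections" "e \<in> E" "v \<in> e"
  shows "qapprox (dobj F (Inr e)) 1 (\<alpha> (Inr e) v a) (dres F v e (vertex_tuple \<alpha> v))"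
  using point_sectionsD(5)[OF assms(1)] assms edge_vertex[of e v] by (simp add: vertex_tuple_def)

section \<open>Homs between transformations\<close>

lemma Hom_point_sections:
  assumes \<alpha>: "\<alpha> \<in> Ob point_sections" and \<beta>: "\<beta> \<in> Ob point_sections"
  shows "Hom point_sections \<alpha> \<beta> =
    (INF v\<in>V. Hom (dobj F (Inl v)) (vertex_tuple \<alpha> v) (vertex_tuple \<beta> v))"
proof -
  let ?h = "INF v\<in>V. Hom (dobj F (Inl v)) (vertex_tuple \<alpha> v) (vertex_tuple \<beta> v)"
  let ?k = "INF e\<in>E. INF v\<in>e. Hom (dobj F (Inr e)) (\<alpha> (Inr e) v a) (\<beta> (Inr e) v a)"
  \<comment> \<open>Pass from the meet to its term at \<open>v\<close>, push that along the
    restriction functor, then exchange both restricted objects for the isomorphic edge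
    components.\<close>
  have edge: "?h \<le> Hom (dobj F (Inr e)) (\<alpha> (Inr e) v a) (\<beta> (Inr e) v a)"
    if e: "e \<in> E" "v \<in> e" for e v
  proof -
    have v: "v \<in> V" using edge_vertex e .
    have "?h \<le> Hom (dobj F (Inl v)) (vertex_tuple \<alpha> v) (vertex_tuple \<beta> v)"
      using v by (rule INF_lower)
    also have "\<dots> \<le> Hom (dobj F (Inr e)) (dres F v e (vertex_tuple \<alpha> v))
        (dres F v e (vertex_tuple \<beta> v))"
      using v by (intro functors_Hom_le[OF sheaf_restriction[OF e]] vertex_tuple_Ob \<alpha> \<beta>)
    also have "\<dots> \<le> Hom (dobj F (Inr e)) (\<alpha> (Inr e) v a) (\<beta> (Inr e) v a)"
      using edge_component_qapprox[OF \<alpha> e] edge_component_qapprox[OF \<beta> e] v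
      by (intro Hom_qapprox_le sheaf_is_qcat e sheaf_restriction_Ob vertex_tuple_Ob
          edge_component_Ob \<alpha> \<beta>) (simp_all add: qapprox_def)
    finally show ?thesis .
  qed
  \<comment> \<open>The meet over \<open>V <+> E\<close> splits into a vertex part \<open>?h\<close>
    and an edge part \<open>?k\<close>; the bound just shown absorbs \<open>?k\<close>.\<close>
  have "Hom point_sections \<alpha> \<beta> = inf ?h ?k"
    by (simp add: pseudonat_qcat_def Plus_def INF_union image_image functor_qcat_def[of "dobj (weight_diagram W) _"])
      (simp add: weight_diagram_def power_diagram_def vertex_tuple_def unit_qcat_def[of "_ :: 'v"])
  also have "\<dots> = ?h"
    using edge by (intro inf_absorb1 INF_greatest)
  finally show ?thesis .
qed

section \<open>Vertex tuples and fuzzy sections\<close>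

lemma vertex_tuple_fuzzy_section:
  assumes \<alpha>: "\<alpha> \<in> Ob point_sections"
  shows "vertex_tuple \<alpha> \<in> fuzzy_sections V E W F"
proof -
  \<comment> \<open>The edge component is a functor, so the weight bounds the hom between its
    values; isomorphism with the restrictions transfers the bound to the tuple.\<close>
  have le: "W v w \<le> Hom (dobj F (Inr e))
      (dres F v e (vertex_tuple \<alpha> v)) (dres F w e (vertex_tuple \<alpha> w))"
    if e: "e \<in> E" "v \<in> e" "w \<in> e" "v \<noteq> w" for e v w
  proof -
    have "W v w \<le> Hom (dobj F (Inr e)) (\<alpha> (Inr e) v a) (\<alpha> (Inr e) w a)"
      using point_sectionsD(4)[OF \<alpha>] e by blast
    also have "\<dots> \<le> Hom (dobj F (Inr e))
        (dres F v e (vertex_tuple \<alpha> v)) (dres F w e (vertex_tuple \<alpha> w))"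
      by (intro Hom_qapprox_le sheaf_is_qcat(2) edge_component_Ob[OF \<alpha>]
          edge_component_qapprox[OF \<alpha>] sheaf_restriction_Ob vertex_tuple_Ob[OF \<alpha>]
          edge_vertex[OF e(1)] e)
    finally show ?thesis .
  qed
  have "vertex_tuple \<alpha> \<in> extensional V"
    by (simp add: vertex_tuple_def)
  then have "vertex_tuple \<alpha> \<in> Ob (zero_cochains V F)"
    using vertex_tuple_Ob[OF \<alpha>] by (simp add: zero_cochains_def PiE_iff)
  then show ?thesis
    unfolding fuzzy_sections_def qle_def
  proof (intro CollectI conjI ballI allI impI)
    \<comment> \<open>An edge has two elements, so \<open>e = {v, w}\<close> forces \<open>v\<close>
      and \<open>w\<close> to be distinct, as \<open>le\<close> requires.\<close>
    fix e v w assume e: "e \<in> E" "e = {v, w}"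
    then have vw: "v \<in> e" "w \<in> e" "v \<noteq> w" "w \<noteq> v"
      using simple_graph_edge(2)[OF G e] by auto
    show "W v w \<le> Hom (dobj F (Inr e))
        (dres F v e (vertex_tuple \<alpha> v)) (dres F w e (vertex_tuple \<alpha> w))"
      using le e(1) vw by blast
    show "W w v \<le> Hom (dobj F (Inr e))
        (dres F w e (vertex_tuple \<alpha> w)) (dres F v e (vertex_tuple \<alpha> v))"
      using le e(1) vw by blast
  qed
qed

text \<open>Taking the restrictions of \<open>x\<close> themselves as edge components makes the
  squares commute strictly. Functoriality of these components is then exactly the fuzzy section
  condition.\<close>

lemma fuzzy_section_vertex_tuple:
  assumes x: "x \<in> fuzzy_sections V E W F"
  obtains \<alpha> where "\<alpha> \<in> Ob point_sections" "vertex_tuple \<alpha> = x"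
proof
  have xv: "x \<in> (\<Pi>\<^sub>E v\<in>V. Ob (dobj F (Inl v)))"
    using x by (simp add: fuzzy_sections_def zero_cochains_def)
  have weight: "W v w \<le> Hom (dobj F (Inr e)) (dres F v e (x v)) (dres F w e (x w))"
    if "e \<in> E" "v \<in> e" "w \<in> e" "v \<noteq> w" for e v w
    using x that simple_graph_edge(3)[OF G that] unfolding fuzzy_sections_def qle_def by blast
  \<comment> \<open>On an edge the object \<open>u\<close> goes to the restriction of
    \<open>x u\<close>. The nested restrictions make every layer extensional, as membership in the
    function sets demands.\<close>
  define \<alpha> where "\<alpha> = (\<lambda>\<sigma>\<in>V <+> E. case \<sigma> of Inl v \<Rightarrow> \<lambda>u\<in>{v}. \<lambda>t\<in>{a}. x v
    | Inr e \<Rightarrow> \<lambda>u\<in>e. \<lambda>t\<in>{a}. dres F u e (x u))"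
  have \<alpha>_vertex: "\<alpha> (Inl v) = (\<lambda>u\<in>{v}. \<lambda>t\<in>{a}. x v)" if "v \<in> V" for v
    using that by (simp add: \<alpha>_def InlI)
  have \<alpha>_edge: "\<alpha> (Inr e) = (\<lambda>u\<in>e. \<lambda>t\<in>{a}. dres F u e (x u))" if "e \<in> E" for e
    using that by (simp add: \<alpha>_def InrI)
  have Ob: "dres F u e (x u) \<in> Ob (dobj F (Inr e))" if "e \<in> E" "u \<in> e" for e u
    using xv edge_vertex that sheaf_restriction_Ob by blast
  show "\<alpha> \<in> Ob point_sections"
    unfolding point_sections_iff
  proof (intro conjI ballI impI)
    show "\<alpha> \<in> extensional (V <+> E)" by (simp add: \<alpha>_def)
  next
    fix e v assume "e \<in> E" "v \<in> e"
    then show "qapprox (dobj F (Inr e)) 1 (\<alpha> (Inr e) v a) (dres F v e (\<alpha> (Inl v) v a))"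
      using Ob edge_vertex[of e v] sheaf_is_qcat(2)
      by (simp add: \<alpha>_vertex \<alpha>_edge qapprox_one_iff is_qcat_Hom_self)
  next
    fix v assume "v \<in> V"
    then show "\<alpha> (Inl v) \<in> {v} \<rightarrow>\<^sub>E {a} \<rightarrow>\<^sub>E Ob (dobj F (Inl v))"
      using PiE_mem[OF xv] by (simp only: \<alpha>_vertex restrict_PiE_iff) simp
  next
    fix e assume "e \<in> E"
    then show "\<alpha> (Inr e) \<in> e \<rightarrow>\<^sub>E {a} \<rightarrow>\<^sub>E Ob (dobj F (Inr e))"
      using Ob by (simp only: \<alpha>_edge restrict_PiE_iff) simp
  next
    fix e v w assume "e \<in> E" "v \<in> e" "w \<in> e" "v \<noteq> w"
    then show "W v w \<le> Hom (dobj F (Inr e)) (\<alpha> (Inr e) v a) (\<alpha> (Inr e) w a)"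
      using weight by (simp add: \<alpha>_edge)
  qed
  show "vertex_tuple \<alpha> = x"
    using xv by (auto simp: vertex_tuple_def \<alpha>_vertex fun_eq_iff PiE_iff extensional_def)
qed

section \<open>Uniqueness over skeletal edge categories\<close>

text \<open>In a skeletal category isomorphic objects coincide, so pseudonaturality becomes strict
  and the tuple determines the edge components. The vertex components are read off from the tuple
  directly.\<close>

lemma vertex_tuple_inj:
  assumes skel: "\<forall>e\<in>E. skeletal (dobj F (Inr e))"
  shows "inj_on vertex_tuple (Ob point_sections)"
proof (rule inj_onI)
  fix \<alpha> \<beta> assume \<alpha>: "\<alpha> \<in> Ob point_sections" and \<beta>: "\<beta> \<in> Ob point_sections"
    and eq: "vertex_tuple \<alpha> = vertex_tuple \<beta>"
  have PiE: "\<gamma> \<in> extensional (V <+> E)"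
    "v \<in> V \<Longrightarrow> \<gamma> (Inl v) \<in> {v} \<rightarrow>\<^sub>E {a} \<rightarrow>\<^sub>E Ob (dobj F (Inl v))"
    "e \<in> E \<Longrightarrow> \<gamma> (Inr e) \<in> e \<rightarrow>\<^sub>E {a} \<rightarrow>\<^sub>E Ob (dobj F (Inr e))"
    if "\<gamma> \<in> Ob point_sections" for \<gamma> v e
    using point_sectionsD(1-3)[OF that] by simp_all
  have restr: "\<gamma> (Inr e) v a = dres F v e (vertex_tuple \<gamma> v)"
    if \<gamma>: "\<gamma> \<in> Ob point_sections" and e: "e \<in> E" "v \<in> e" for \<gamma> e v
  proof -
    have "dres F v e (vertex_tuple \<gamma> v) \<in> Ob (dobj F (Inr e))"
      by (intro sheaf_restriction_Ob vertex_tuple_Ob \<gamma> edge_vertex[OF e] e)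
    then show ?thesis
      using skel e edge_component_Ob[OF \<gamma> e] edge_component_qapprox[OF \<gamma> e]
      unfolding skeletal_def by blast
  qed
  show "\<alpha> = \<beta>"
  proof (rule extensionalityI[OF PiE(1)[OF \<alpha>] PiE(1)[OF \<beta>]])
    fix \<sigma> assume "\<sigma> \<in> V <+> E"
    then show "\<alpha> \<sigma> = \<beta> \<sigma>"
    proof (elim PlusE)
      fix v assume v: "v \<in> V" "\<sigma> = Inl v"
      have "\<alpha> (Inl v) v a = \<beta> (Inl v) v a"
        using fun_cong[OF eq, of v] v by (simp add: vertex_tuple_def)
      then have "\<alpha> (Inl v) v = \<beta> (Inl v) v"
        using PiE(2)[OF \<alpha> v(1)] PiE(2)[OF \<beta> v(1)] by (auto intro!: PiE_ext[of _ "{a}"])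
      then show ?thesis
        unfolding v(2) by (intro PiE_ext[OF PiE(2)[OF \<alpha> v(1)] PiE(2)[OF \<beta> v(1)]]) simp
    next
      fix e assume e: "e \<in> E" "\<sigma> = Inr e"
      have "\<alpha> (Inr e) u = \<beta> (Inr e) u" if u: "u \<in> e" for u
      proof (rule PiE_ext)
        show "\<alpha> (Inr e) u \<in> {a} \<rightarrow>\<^sub>E Ob (dobj F (Inr e))" "\<beta> (Inr e) u \<in> {a} \<rightarrow>\<^sub>E Ob (dobj F (Inr e))"
          using PiE(3)[OF \<alpha> e(1)] PiE(3)[OF \<beta> e(1)] u by auto
      qed (simp add: restr[OF \<alpha> e(1) u] restr[OF \<beta> e(1) u] eq)
      then show ?thesis
        unfolding e(2) by (rule PiE_ext[OF PiE(3)[OF \<alpha> e(1)] PiE(3)[OF \<beta> e(1)]])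
    qed
  qed
qed

end

section \<open>Transport to the weighted limit\<close>

theorem theorem3p6:
  fixes V :: "'v set" and E :: "'v set set"
    and W :: "'v \<Rightarrow> 'v \<Rightarrow> 'q::semicartesian_quantale"
    and F :: "('v, 'o, 'q) diagram"
    and \<Gamma> :: "('l, 'q) qcat"
    and \<theta> :: "('x, 'q) qcat \<Rightarrow> ('x \<Rightarrow> 'l) \<Rightarrow> ('v + 'v set \<Rightarrow> 'v \<Rightarrow> 'x \<Rightarrow> 'o)"
    and a :: 'x
  assumes "simple_graph V E"
    and "network_sheaf V E F"
    and "is_weighted_global_sections V E W F \<Gamma> \<theta>"
  shows
    "underlying_tuple V \<theta> a ` Ob \<Gamma> = fuzzy_sections V E W F \<and>
     (\<forall>g\<in>Ob \<Gamma>. \<forall>h\<in>Ob \<Gamma>. underlying_tuple V \<theta> a g = underlying_tuple V \<theta> a h \<longrightarrow> qapprox \<Gamma> 1 g h) \<and>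
     ((\<forall>e\<in>E. skeletal (dobj F (Inr e))) \<longrightarrow>
        bij_betw (underlying_tuple V \<theta> a) (Ob \<Gamma>) (fuzzy_sections V E W F)) \<and>
     (\<forall>x\<in>fuzzy_sections V E W F. \<forall>y\<in>fuzzy_sections V E W F. \<forall>g\<in>Ob \<Gamma>. \<forall>h\<in>Ob \<Gamma>.
        underlying_tuple V \<theta> a g = x \<longrightarrow> underlying_tuple V \<theta> a h = y \<longrightarrow>
        Hom \<Gamma> g h = Hom (zero_cochains V F) x y \<and>
        Hom (zero_cochains V F) x y = (INF v\<in>V. Hom (dobj F (Inl v)) (x v) (y v)))"
proof -
  let ?I = "unit_qcat a :: ('x, 'q) qcat"
  let ?P = "point_sections V E W F a" and ?t = "vertex_tuple V a"
  let ?const = "\<lambda>g. \<lambda>_\<in>{a}. g" and ?\<phi> = "\<lambda>g. \<theta> ?I (\<lambda>_\<in>{a}. g)"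
  note ctx = assms(1,2)
  note limit = assms(3)[unfolded is_weighted_limit_def]
  have \<Gamma>: "is_qcat \<Gamma>"
    using limit by (rule conjunct1)
  have iso: "is_qiso (functor_qcat ?I \<Gamma>) ?P (\<theta> ?I)"
    by (rule limit[THEN conjunct2, THEN conjunct1, rule_format, OF is_qcat_unit_qcat])
  have const: "bij_betw ?const (Ob \<Gamma>) (Ob (functor_qcat ?I \<Gamma>))"
    using functor_qcat_unit_qcat_bij_betw[OF \<Gamma>] by simp
  \<comment> \<open>An object of \<open>\<Gamma>\<close> is a constant functor from the one-object
    category, which the limit isomorphism turns into a transformation.\<close>
  have bij: "bij_betw ?\<phi> (Ob \<Gamma>) (Ob ?P)"
    using bij_betw_trans[OF const is_qiso_bij_betw[OF iso]] by (simp add: comp_def)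
  have \<phi>: "?\<phi> g \<in> Ob ?P" if "g \<in> Ob \<Gamma>" for g
    using bij_betwE[OF bij] that by blast
  \<comment> \<open>This factorization through \<open>?\<phi>\<close> reduces all claims about
    underlying tuples to claims about vertex tuples.\<close>
  have tuple: "underlying_tuple V \<theta> a = ?t \<circ> ?\<phi>"
    by (simp add: fun_eq_iff underlying_tuple_def vertex_tuple_def[OF ctx])
  have image: "?t ` Ob ?P = fuzzy_sections V E W F"
  proof (intro equalityI image_subsetI subsetI)
    show "?t \<alpha> \<in> fuzzy_sections V E W F" if "\<alpha> \<in> Ob ?P" for \<alpha>
      using that by (rule vertex_tuple_fuzzy_section[OF ctx])
    show "x \<in> ?t ` Ob ?P" if "x \<in> fuzzy_sections V E W F" for x
      by (rule fuzzy_section_vertex_tuple[OF ctx that]) (rule image_eqI[OF sym])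
  qed
  have hom: "Hom \<Gamma> g h = (INF v\<in>V. Hom (dobj F (Inl v))
      (underlying_tuple V \<theta> a g v) (underlying_tuple V \<theta> a h v))"
    if "g \<in> Ob \<Gamma>" "h \<in> Ob \<Gamma>" for g h
  proof -
    have "Hom \<Gamma> g h = Hom ?P (?\<phi> g) (?\<phi> h)"
      using is_qiso_Hom[OF iso, of "?const g" "?const h"] bij_betwE[OF const] that by simp
    then show ?thesis
      by (simp only: Hom_point_sections[OF ctx \<phi>[OF that(1)] \<phi>[OF that(2)]] tuple comp_apply)
  qed
  \<comment> \<open>Homs in \<open>\<Gamma>\<close> depend only on the underlying tuples, so
    \<open>h\<close> may be replaced by \<open>g\<close>, and the self-hom of \<open>g\<close> is
    1.\<close>
  have approx: "qapprox \<Gamma> 1 g h"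
    if g: "g \<in> Ob \<Gamma>" and h: "h \<in> Ob \<Gamma>" and eq: "underlying_tuple V \<theta> a g = underlying_tuple V \<theta> a h"
    for g h
  proof -
    have "Hom \<Gamma> g h = Hom \<Gamma> g g" "Hom \<Gamma> h g = Hom \<Gamma> g g"
      using hom g h eq by simp_all
    then show ?thesis
      using is_qcat_Hom_self[OF \<Gamma> g] by (simp add: qapprox_one_iff)
  qed
  have skel: "bij_betw (underlying_tuple V \<theta> a) (Ob \<Gamma>) (fuzzy_sections V E W F)"
    if "\<forall>e\<in>E. skeletal (dobj F (Inr e))"
    unfolding tuple
    by (rule bij_betw_trans[OF bij bij_betw_imageI[OF vertex_tuple_inj[OF ctx that] image]])
  have "underlying_tuple V \<theta> a ` Ob \<Gamma> = fuzzy_sections V E W F"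
    unfolding tuple image_comp[symmetric] bij_betw_imp_surj_on[OF bij] by (rule image)
  then show ?thesis
    using approx skel hom by (simp add: zero_cochains_def)
qed

end
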